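(* Let $(\Omega,\mathcal F,\mathbb P)$, $(\tau_i)_{i\in\mathbb Z}$ and the random potential $J$ be as in the context; in particular $J$ satisfies (A1)--(A4). For $n\in\mathbb N$ let $\ell_n^*(\omega)$ be the critical stretch of the chain with $n+1$ particles, and let $\delta(\omega)$ be the ground state (unique minimizer) of $J(\omega,\cdot)$. Then $$\lim_{n\to\infty}\ell_n^*(\omega)=\mathbb E[\delta]\qquad\text{for }\mathbb P\text{-a.e. }\omega\in\Omega.$$
   Context: Probabilistic setup. $(\Omega,\mathcal F,\mathbb P)$ is a probability space, $\mathbb E$ denotes expectation, and $(\tau_i)_{i\in\mathbb Z}$ is a family of measurable maps $\tau_i:\Omega\to\Omega$ such that: (group property) $\tau_0\omega=\omega$ for all $\omega\in\Omega$ and $\tau_{i_1+i_2}=\tau_{i_1}\tau_{i_2}$ for all $i_1,i_2\in\mathbb Z$; (stationarity) $\mathbb P(\tau_iB)=\mathbb P(B)$ for every $B\in\mathcal F$ and $i\in\mathbb Z$; (ergodicity) for every $B\in\mathcal F$, if $\tau_i(B)=B$ for all $i\in\mathbb Z$, then $\mathbb P(B)=0$ or $\mathbb P(B)=1$. Assumptions on the potential. "Monotonically increasing" is understood in the non-strict sense. $J:\Omega\times\mathbb R\to\mathbb R\cup\{+\infty\}$ is jointly measurable with $J(\omega,z)=+\infty$ if $z\le 0$. Primes denote derivatives in $z$. For $\mathbb P$-a.e. $\omega\in\Omega$ the following hold: (A1) $J(\omega,\cdot)\in C^3(0,\infty)$ (in particular finite there). (A2) There exist functions $\psi^+,\psi^-\in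 C(0,\infty)$, independent of $\omega$, with $\lim_{z\to0^+}\psi^-(z)=\infty$ and $\lim_{z\to\infty}\psi^+(z)=0$, such that $J(\omega,z)\ge\psi^-(z)$ for all $0<z\le1$ and $|J(\omega,z)|\le\psi^+(z)$ for all $z\ge1$. (A3) $z_{\mathrm{frac}}(\omega):=\sup\{z>0: J''(\omega,s)>0\text{ for all }s\in(0,z)\}>0$, and $J(\omega,\cdot)$ is monotonically increasing on $[z_{\mathrm{frac}}(\omega),\infty)$. $J(\omega,\cdot)$ admits a unique minimizer, denoted $\delta(\omega)$ and called the ground state. (A4) There exists a constant $c>0$, independent of $\omega$, such that $c<\delta(\omega)<\frac1c$ and for all $z\in(\delta(\omega)-c,\delta(\omega)+c)$: $c\le J''(\omega,z)\le\frac1c$ and $|J'''(\omega,z)|\le\frac1c$. Discrete chain. For $n\in\mathbb N$, $\mathcal A_n$ is the set of $u\in C([0,1])$ that are affine on $(\frac in,\frac{i+1}n)$ for every $i\in\{0,\dots,n-1\}$ and monotonically increasing. For $\ell\ge0$, $\mathcal A_{n,\ell}:=\{u\in\mathcal A_n: u(0)=0,\ u(1)=\ell\}$. The energy is $$E_n(\omega,u):=\sum_{i=0}^{n-1}\frac1nJ\Big(\tau_i\omega,n\big(u(\tfrac{i+1}n)-u(\tfrac in)\big)\Big).$$ The set of purely elastic deformations is $$\mathcal A_n^{\rm el}(\omega):=\Big\{u\in\mathcal A_n: n\big(u(\tfrac{i+1}n)-u(\tfrac in)\big)\le z_{\mathrm{frac}}(\tau_i\omega)\text{ for all }i=0,\dots,n-1\Big\}.$$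 The critical stretch $\ell_n^*(\omega)$ is the largest number such that $$\inf_{\mathcal A_n^{\rm el}(\omega)\cap\mathcal A_{n,\ell}}E_n(\omega,\cdot)=\inf_{\mathcal A_{n,\ell}}E_n(\omega,\cdot)\qquad\text{for all }0\le\ell<\ell_n^*(\omega),$$ with the convention $\inf\emptyset=+\infty$. *)

theory Defs
  imports "HOL-Probability.Probability"
begin

section \<open>The stationary ergodic environment\<close>

locale ergodic_int_action = prob_space M
  for M :: "'a measure" +
  fixes \<tau> :: "int \<Rightarrow> 'a \<Rightarrow> 'a"
  assumes shift_measurable: "\<And>i. \<tau> i \<in> measurable M M"
    and shift_zero: "\<And>\<omega>. \<omega> \<in> space M \<Longrightarrow> \<tau> 0 \<omega> = \<omega>"
    and shift_add: "\<And>i j \<omega>. \<omega> \<in> space M \<Longrightarrow> \<tau> (i + j) \<omega> = \<tau> i (\<tau> j \<omega>)"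
    and stationary: "\<And>B i. B \<in> sets M \<Longrightarrow> prob (\<tau> i ` B) = prob B"
    and ergodic: "\<And>B. B \<in> sets M \<Longrightarrow> (\<forall>i. \<tau> i ` B = B) \<Longrightarrow> prob B = 0 \<or> prob B = 1"

section \<open>The interaction potential\<close>

text \<open>In this section \<open>W\<close> stands for the potential \<open>J \<omega>\<close> at a fixed \<open>\<omega>\<close>. It is extended-real
  valued; its derivatives are those of its real part, and are only used on \<open>(0,\<infinity>)\<close>, where \<open>W\<close> is
  finite by (A1).\<close>

definition pot_deriv :: "nat \<Rightarrow> (real \<Rightarrow> ereal) \<Rightarrow> real \<Rightarrow> real" where
  "pot_deriv k W = (deriv ^^ k) (\<lambda>z. real_of_ereal (W z))"

definition C3_pos :: "(real \<Rightarrow> ereal) \<Rightarrow> bool" where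
  "C3_pos W \<longleftrightarrow>
     (\<forall>z>0. \<bar>W z\<bar> \<noteq> \<infinity>) \<and>
     (\<forall>k<3. \<forall>z>0. pot_deriv k W differentiable (at z)) \<and>
     continuous_on {0<..} (pot_deriv 3 W)"

text \<open>The supremum is taken in the extended reals, so that it needs no boundedness
  or nonemptiness convention.\<close>

definition z_frac :: "(real \<Rightarrow> ereal) \<Rightarrow> ereal" where
  "z_frac W = (SUP z\<in>{z. 0 < z \<and> (\<forall>s\<in>{0<..<z}. 0 < pot_deriv 2 W s)}. ereal z)"

definition ground_state :: "(real \<Rightarrow> ereal) \<Rightarrow> real" where
  "ground_state W = (THE z. is_arg_min W (\<lambda>_. True) z)"

text \<open>The functions \<open>\<psi>\<^sup>+\<close>, \<open>\<psi>\<^sup>-\<close> and the constant \<open>c\<close> are chosen before \<open>\<omega>\<close>.\<close>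

locale random_potential = prob_space M
  for M :: "'a measure" +
  fixes J :: "'a \<Rightarrow> real \<Rightarrow> ereal"
  assumes potential_measurable: "(\<lambda>(\<omega>, z). J \<omega> z) \<in> borel_measurable (M \<Otimes>\<^sub>M borel)"
    and potential_not_MInf: "\<And>\<omega> z. \<omega> \<in> space M \<Longrightarrow> J \<omega> z \<noteq> -\<infinity>"
    and potential_nonpos: "\<And>\<omega> z. \<omega> \<in> space M \<Longrightarrow> z \<le> 0 \<Longrightarrow> J \<omega> z = \<infinity>"
    and A1: "AE \<omega> in M. C3_pos (J \<omega>)"
    and A2: "\<exists>\<psi>p \<psi>m :: real \<Rightarrow> real.
      continuous_on {0<..} \<psi>p \<and> continuous_on {0<..} \<psi>m \<and>
      filterlim \<psi>m at_top (at_right 0) \<and> (\<psi>p \<longlongrightarrow> 0) at_top \<and>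
      (AE \<omega> in M. (\<forall>z. 0 < z \<and> z \<le> 1 \<longrightarrow> ereal (\<psi>m z) \<le> J \<omega> z) \<and>
                   (\<forall>z\<ge>1. \<bar>J \<omega> z\<bar> \<le> ereal (\<psi>p z)))"
    and A3: "AE \<omega> in M. 0 < z_frac (J \<omega>) \<and> mono_on {z. z_frac (J \<omega>) \<le> ereal z} (J \<omega>)"
    and unique_minimizer: "AE \<omega> in M. \<exists>!z. is_arg_min (J \<omega>) (\<lambda>_. True) z"
    and A4: "\<exists>c>0. AE \<omega> in M.
      c < ground_state (J \<omega>) \<and> ground_state (J \<omega>) < 1 / c \<and>
      (\<forall>z\<in>{ground_state (J \<omega>) - c <..< ground_state (J \<omega>) + c}.
         c \<le> pot_deriv 2 (J \<omega>) z \<and> pot_deriv 2 (J \<omega>) z \<le> 1 / c \<and>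
         \<bar>pot_deriv 3 (J \<omega>) z\<bar> \<le> 1 / c)"

text \<open>For a \<open>\<sigma>\<close>-algebra that is not complete, (A1)--(A4) determine the ground state only off a null
  set, so \<open>\<lambda>\<omega>. ground_state (J \<omega>)\<close> is in general merely almost everywhere equal to an
  \<open>M\<close>-measurable function. Its expectation is therefore taken with respect to the completed
  measure, which agrees with the one under \<open>M\<close> whenever the function is \<open>M\<close>-measurable.\<close>

definition mean_ground_state :: "'a measure \<Rightarrow> ('a \<Rightarrow> real \<Rightarrow> ereal) \<Rightarrow> real" where
  "mean_ground_state M J = (\<integral>\<omega>. ground_state (J \<omega>) \<partial>completion M)"

section \<open>The discrete chain\<close>

text \<open>Deformations are functions on all of \<open>\<real>\<close> of which only the restriction to \<open>[0,1]\<close> matters.\<close>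

definition deformations :: "nat \<Rightarrow> (real \<Rightarrow> real) set" where
  "deformations n =
     {u. continuous_on {0..1} u \<and>
         (\<forall>i<n. \<exists>a b. \<forall>x\<in>{real i / real n <..< real (i + 1) / real n}. u x = a * x + b) \<and>
         mono_on {0..1} u}"

definition clamped_deformations :: "nat \<Rightarrow> real \<Rightarrow> (real \<Rightarrow> real) set" where
  "clamped_deformations n l = {u \<in> deformations n. u 0 = 0 \<and> u 1 = l}"

definition bond_stretch :: "nat \<Rightarrow> (real \<Rightarrow> real) \<Rightarrow> nat \<Rightarrow> real" where
  "bond_stretch n u i = real n * (u (real (i + 1) / real n) - u (real i / real n))"

definition energy ::
  "(int \<Rightarrow> 'a \<Rightarrow> 'a) \<Rightarrow> ('a \<Rightarrow> real \<Rightarrow> ereal) \<Rightarrow> nat \<Rightarrow> 'a \<Rightarrow> (real \<Rightarrow> real) \<Rightarrow> ereal" where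
  "energy \<tau> J n \<omega> u = (\<Sum>i<n. ereal (1 / real n) * J (\<tau> (int i) \<omega>) (bond_stretch n u i))"

definition elastic_deformations ::
  "(int \<Rightarrow> 'a \<Rightarrow> 'a) \<Rightarrow> ('a \<Rightarrow> real \<Rightarrow> ereal) \<Rightarrow> nat \<Rightarrow> 'a \<Rightarrow> (real \<Rightarrow> real) set" where
  "elastic_deformations \<tau> J n \<omega> =
     {u \<in> deformations n. \<forall>i<n. ereal (bond_stretch n u i) \<le> z_frac (J (\<tau> (int i) \<omega>))}"

definition elastically_optimal_below ::
  "(int \<Rightarrow> 'a \<Rightarrow> 'a) \<Rightarrow> ('a \<Rightarrow> real \<Rightarrow> ereal) \<Rightarrow> nat \<Rightarrow> 'a \<Rightarrow> ereal \<Rightarrow> bool" where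
  "elastically_optimal_below \<tau> J n \<omega> L \<longleftrightarrow>
     (\<forall>l::real. 0 \<le> l \<and> ereal l < L \<longrightarrow>
        (INF u\<in>elastic_deformations \<tau> J n \<omega> \<inter> clamped_deformations n l. energy \<tau> J n \<omega> u) =
        (INF u\<in>clamped_deformations n l. energy \<tau> J n \<omega> u))"

text \<open>The largest such number is sought in the extended reals, where it always exists;
  on an exceptional set of \<open>\<omega>\<close> it may be infinite.\<close>

definition critical_stretch ::
  "(int \<Rightarrow> 'a \<Rightarrow> 'a) \<Rightarrow> ('a \<Rightarrow> real \<Rightarrow> ereal) \<Rightarrow> nat \<Rightarrow> 'a \<Rightarrow> ereal" where
  "critical_stretch \<tau> J n \<omega> = (GREATEST L. elastically_optimal_below \<tau> J n \<omega> L)"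

lemma critical_stretch_eq_Sup:
  "critical_stretch \<tau> J n \<omega> = Sup {L. elastically_optimal_below \<tau> J n \<omega> L}"
  unfolding critical_stretch_def
proof (rule Greatest_equality)
  show "elastically_optimal_below \<tau> J n \<omega> (Sup {L. elastically_optimal_below \<tau> J n \<omega> L})"
    unfolding elastically_optimal_below_def less_Sup_iff by blast
qed (simp add: Sup_upper)

lemma critical_stretch_optimal:
  "elastically_optimal_below \<tau> J n \<omega> (critical_stretch \<tau> J n \<omega>)"
  unfolding critical_stretch_eq_Sup
  unfolding elastically_optimal_below_def less_Sup_iff by blast

end

theory Submission
  imports Defs
begin

text \<open>Up to the mean of the ground states \<open>\<delta>\<^sub>i\<close> a deformation can be made elastic without raising its
  energy: stretches above \<open>\<delta>\<^sub>i\<close> are lowered to \<open>\<delta>\<^sub>i\<close>, and those below are moved towards \<open>\<delta>\<^sub>i\<close> until the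
  total length is restored. Past that mean by a fixed \<open>\<epsilon>\<close>, convexity on \<open>(0, z_frac)\<close> and
  the uniform curvature at \<open>\<delta>\<^sub>i\<close> force every elastic chain of \<open>n\<close> bonds to pay an unscaled energy of
  order \<open>n\<close> above the ground state, while a chain whose only stretched bond is broken
  pays a bounded amount. So the critical stretch is the ergodic average of \<open>\<delta>\<close> up to
  a vanishing error, and Birkhoff's theorem gives the limit.\<close>

section \<open>Birkhoff's ergodic theorem\<close>

context ergodic_int_action
begin

section \<open>Measure preservation and ergodicity of the shifts\<close>

lemma shift_in_space: "\<omega> \<in> space M \<Longrightarrow> \<tau> i \<omega> \<in> space M"
  using shift_measurable[of i] by (rule measurable_space)

lemma shift_inverse: "\<omega> \<in> space M \<Longrightarrow> \<tau> i (\<tau> (- i) \<omega>) = \<omega>"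
  using shift_add[of \<omega> i "- i"] by (simp add: shift_zero)

lemma shift_Suc: "\<omega> \<in> space M \<Longrightarrow> \<tau> (int (Suc k)) \<omega> = \<tau> (int k) (\<tau> 1 \<omega>)"
  using shift_add[of \<omega> "int k" 1] by (simp add: add.commute)

text \<open>Stationarity and ergodicity are stated with images, while measurability and
  \<open>distr\<close> work with preimages; the group inverse trades one for the other.\<close>

lemma vimage_shift_eq_image:
  assumes "B \<subseteq> space M"
  shows "\<tau> i -` B \<inter> space M = \<tau> (- i) ` B"
proof (intro set_eqI iffI)
  fix \<omega> assume "\<omega> \<in> \<tau> i -` B \<inter> space M"
  then show "\<omega> \<in> \<tau> (- i) ` B"
    using shift_inverse[of \<omega> "- i"] by (intro image_eqI[of _ _ "\<tau> i \<omega>"]) auto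
next
  fix \<omega> assume "\<omega> \<in> \<tau> (- i) ` B"
  then show "\<omega> \<in> \<tau> i -` B \<inter> space M"
    using assms shift_inverse[of _ i] shift_in_space by auto
qed

lemma distr_shift: "distr M M (\<tau> i) = M"
proof (rule measure_eqI)
  fix B assume "B \<in> sets (distr M M (\<tau> i))"
  then have B: "B \<in> sets M" by simp
  then have "prob (\<tau> i -` B \<inter> space M) = prob B"
    using stationary[OF B] by (simp add: vimage_shift_eq_image sets.sets_into_space)
  then show "emeasure (distr M M (\<tau> i)) B = emeasure M B"
    using B by (simp add: emeasure_distr shift_measurable emeasure_eq_measure)
qed simp

lemma
  fixes f :: "'a \<Rightarrow> real"
  assumes "integrable M f"
  shows integrable_shift: "integrable M (\<lambda>\<omega>. f (\<tau> i \<omega>))"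
    and integral_shift: "(\<integral>\<omega>. f (\<tau> i \<omega>) \<partial>M) = (\<integral>\<omega>. f \<omega> \<partial>M)"
proof -
  have f: "f \<in> borel_measurable M" using assms by simp
  show "integrable M (\<lambda>\<omega>. f (\<tau> i \<omega>))"
    using integrable_distr_eq[OF shift_measurable[of i] f] assms by (simp add: distr_shift)
  show "(\<integral>\<omega>. f (\<tau> i \<omega>) \<partial>M) = (\<integral>\<omega>. f \<omega> \<partial>M)"
    using integral_distr[OF shift_measurable[of i] f] by (simp add: distr_shift)
qed

text \<open>A shift preserves the measure, hence null sets, and there are countably many shifts, so
  a single null set serves the whole orbit.\<close>

lemma AE_shift:
  assumes "AE \<omega> in M. P \<omega>"
  shows "AE \<omega> in M. \<forall>i. P (\<tau> i \<omega>)"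
proof (subst AE_all_countable, rule allI)
  fix i
  have "AE \<omega> in distr M M (\<tau> i). P \<omega>"
    using assms by (subst distr_shift)
  then show "AE \<omega> in M. P (\<tau> i \<omega>)"
    by (rule AE_distrD[OF shift_measurable])
qed

text \<open>Invariance under the generator spreads to nonnegative powers by induction, and to
  negative ones by shifting back from \<open>\<tau> i \<omega>\<close> to
  \<open>\<omega>\<close>.\<close>

lemma ergodic_shift_one:
  assumes B: "B \<in> sets M" and inv: "\<And>\<omega>. \<omega> \<in> space M \<Longrightarrow> \<tau> 1 \<omega> \<in> B \<longleftrightarrow> \<omega> \<in> B"
  shows "prob B = 0 \<or> prob B = 1"
proof (rule ergodic[OF B], rule allI)
  fix i :: int
  have nat: "\<tau> (int k) \<omega> \<in> B \<longleftrightarrow> \<omega> \<in> B" if "\<omega> \<in> space M" for k \<omega>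
    using that
  proof (induction k arbitrary: \<omega>)
    case (Suc k)
    then show ?case using Suc.IH[of "\<tau> 1 \<omega>"] by (simp only: shift_Suc shift_in_space inv)
  qed (simp add: shift_zero)
  have all: "\<tau> i \<omega> \<in> B \<longleftrightarrow> \<omega> \<in> B" if "\<omega> \<in> space M" for i \<omega>
  proof (cases "0 \<le> i")
    case True
    then show ?thesis using nat[OF that, of "nat i"] by simp
  next
    case False
    then show ?thesis
      using nat[OF shift_in_space[OF that], of "nat (- i)" i] shift_inverse[OF that, of "- i"] by simp
  qed
  show "\<tau> i ` B = B"
  proof -
    have "\<tau> i ` B = \<tau> (- i) -` B \<inter> space M"
      using vimage_shift_eq_image[of B "- i"] sets.sets_into_space[OF B] by simp
    then show ?thesis using sets.sets_into_space[OF B] all by blast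
  qed
qed

text \<open>\<open>positive_max g N\<close> is the maximum of the partial sums \<open>\<Sum>i<k. g \<circ> \<tau> i\<close> over \<open>k \<le> N\<close>, in the
  recursive form that Garsia's argument needs.\<close>

primrec positive_max :: "('a \<Rightarrow> real) \<Rightarrow> nat \<Rightarrow> 'a \<Rightarrow> real" where
  "positive_max g 0 \<omega> = 0"
| "positive_max g (Suc N) \<omega> = max 0 (g \<omega> + positive_max g N (\<tau> 1 \<omega>))"

lemma positive_max_nonneg: "0 \<le> positive_max g N \<omega>"
  by (cases N) auto

lemma positive_max_mono: "mono (\<lambda>N. positive_max g N \<omega>)"
proof (rule incseq_SucI)
  show "positive_max g N \<omega> \<le> positive_max g (Suc N) \<omega>" for N
    by (induction N arbitrary: \<omega>) (auto simp: max.coboundedI2)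
qed

lemma sum_le_positive_max:
  "\<omega> \<in> space M \<Longrightarrow> (\<Sum>i<N. g (\<tau> (int i) \<omega>)) \<le> positive_max g N \<omega>"
proof (induction N arbitrary: \<omega>)
  case (Suc N)
  have "(\<Sum>i<Suc N. g (\<tau> (int i) \<omega>)) = g \<omega> + (\<Sum>i<N. g (\<tau> (int i) (\<tau> 1 \<omega>)))"
    using Suc.prems by (simp only: sum.lessThan_Suc_shift shift_Suc shift_zero int_ops(1))
  then show ?case
    using Suc.IH[OF shift_in_space[OF Suc.prems], of 1] by simp
qed simp

lemma integrable_positive_max: "integrable M g \<Longrightarrow> integrable M (positive_max g N)"
proof (induction N)
  case (Suc N)
  have "integrable M (\<lambda>\<omega>. max 0 (g \<omega> + positive_max g N (\<tau> 1 \<omega>)))"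
    using Suc integrable_shift[of "positive_max g N" 1] by simp
  moreover have "positive_max g (Suc N) = (\<lambda>\<omega>. max 0 (g \<omega> + positive_max g N (\<tau> 1 \<omega>)))"
    by (simp add: fun_eq_iff)
  ultimately show ?case by simp
next
  case 0
  have "positive_max g 0 = (\<lambda>_. 0)"
    by (simp add: fun_eq_iff)
  then show ?case by simp
qed

text \<open>The set where the maxima are unbounded is invariant. If it had full measure, then
  \<open>positive_max g (Suc N) - positive_max g N \<circ> \<tau> 1\<close>, whose integral is nonnegative, would tend to \<open>g\<close>.\<close>

lemma bounded_partial_sums_AE:
  fixes g :: "'a \<Rightarrow> real"
  assumes g: "integrable M g" and neg: "(\<integral>\<omega>. g \<omega> \<partial>M) < 0"
  shows "AE \<omega> in M. \<exists>K. \<forall>N. (\<Sum>i<N. g (\<tau> (int i) \<omega>)) \<le> K"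
proof -
  let ?h = "positive_max g"
  define B where "B = {\<omega> \<in> space M. \<forall>k::nat. \<exists>N. real k < ?h N \<omega>}"
  have [measurable]: "?h N \<in> borel_measurable M" for N
    using integrable_positive_max[OF g] by simp
  have B: "B \<in> sets M"
    unfolding B_def by measurable
  have inv: "\<tau> 1 \<omega> \<in> B \<longleftrightarrow> \<omega> \<in> B" if \<omega>: "\<omega> \<in> space M" for \<omega>
  proof
    assume *: "\<tau> 1 \<omega> \<in> B"
    \<comment> \<open>The recursion gives \<open>g \<omega> + ?h N (\<tau> 1 \<omega>) \<le> ?h (Suc
      N) \<omega>\<close>, and the fixed number \<open>g \<omega>\<close> cannot spoil
      unboundedness.\<close>
    have "\<exists>N. real k < ?h N \<omega>" for k
    proof -
      obtain m :: nat where m: "real k - g \<omega> < real m" using reals_Archimedean2 by blast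
      obtain N where "real m < ?h N (\<tau> 1 \<omega>)" using * by (auto simp: B_def)
      then show ?thesis using m by (intro exI[of _ "Suc N"]) auto
    qed
    then show "\<omega> \<in> B" using \<omega> by (simp add: B_def)
  next
    assume *: "\<omega> \<in> B"
    \<comment> \<open>A maximum above \<open>real m\<close> is positive, so its index is not 0 and
      it is attained by the second entry of the recursion.\<close>
    have "\<exists>N. real k < ?h N (\<tau> 1 \<omega>)" for k
    proof -
      obtain m :: nat where m: "real k + g \<omega> < real m" using reals_Archimedean2 by blast
      obtain N where N: "real m < ?h N \<omega>" using * by (auto simp: B_def)
      then obtain N' where "N = Suc N'" by (cases N) auto
      then show ?thesis using m N by (intro exI[of _ N']) (auto simp: max_def split: if_splits)
    qed
    then show "\<tau> 1 \<omega> \<in> B" using shift_in_space[OF \<omega>] by (simp add: B_def)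
  qed
  have "prob B \<noteq> 1"
  proof
    assume "prob B = 1"
    then have AEB: "AE \<omega> in M. \<omega> \<in> B" using prob_eq_1[OF B] by simp
    let ?d = "\<lambda>N \<omega>. ?h (Suc N) \<omega> - ?h N (\<tau> 1 \<omega>)"
    \<comment> \<open>In this form both requirements of dominated convergence are visible:
      \<open>?h\<close> is nonnegative, so the modulus is at most
      \<open>\<bar>g \<omega>\<bar>\<close>, and the value is \<open>g \<omega>\<close> once
      \<open>?h N (\<tau> 1 \<omega>)\<close> exceeds \<open>- g \<omega>\<close>.\<close>
    have d: "?d N \<omega> = max (- ?h N (\<tau> 1 \<omega>)) (g \<omega>)" for N \<omega> by auto
    have "(\<lambda>N. \<integral>\<omega>. ?d N \<omega> \<partial>M) \<longlonglongrightarrow> (\<integral>\<omega>. g \<omega> \<partial>M)"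
    proof (rule integral_dominated_convergence[where w = "\<lambda>\<omega>. \<bar>g \<omega>\<bar>"])
      show "AE \<omega> in M. (\<lambda>N. ?d N \<omega>) \<longlonglongrightarrow> g \<omega>"
        using AEB AE_space
      proof eventually_elim
        case (elim \<omega>)
        obtain k :: nat where k: "- g \<omega> < real k" using reals_Archimedean2 by blast
        have "\<tau> 1 \<omega> \<in> B" using elim inv by blast
        then obtain N where N: "real k < ?h N (\<tau> 1 \<omega>)" by (auto simp: B_def)
        have "\<forall>\<^sub>F n in sequentially. ?d n \<omega> = g \<omega>"
          using eventually_ge_at_top[of N]
        proof eventually_elim
          case (elim n)
          then have "?h N (\<tau> 1 \<omega>) \<le> ?h n (\<tau> 1 \<omega>)" using positive_max_mono by (rule monoD[rotated])
          then show ?case unfolding d using k N by simp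
        qed
        then show ?case by (rule tendsto_eventually)
      qed
      show "AE \<omega> in M. norm (?d N \<omega>) \<le> \<bar>g \<omega>\<bar>" for N
      proof (rule AE_I2)
        show "norm (?d N \<omega>) \<le> \<bar>g \<omega>\<bar>" for \<omega>
          unfolding d using positive_max_nonneg[of g N "\<tau> 1 \<omega>"] by auto
      qed
      show "?d N \<in> borel_measurable M" for N
        by (intro borel_measurable_diff borel_measurable_integrable integrable_shift
            integrable_positive_max g)
    qed (use g in auto)
    \<comment> \<open>The integral is shift invariant, so this compares two successive maxima at the
      same point.\<close>
    moreover have "0 \<le> (\<integral>\<omega>. ?d N \<omega> \<partial>M)" for N
    proof -
      have "(\<integral>\<omega>. ?d N \<omega> \<partial>M) = (\<integral>\<omega>. ?h (Suc N) \<omega> \<partial>M) - (\<integral>\<omega>. ?h N \<omega> \<partial>M)"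
        unfolding integral_shift[OF integrable_positive_max[OF g], symmetric, of N 1]
        by (intro Bochner_Integration.integral_diff integrable_positive_max integrable_shift g)
      moreover have "(\<integral>\<omega>. ?h N \<omega> \<partial>M) \<le> (\<integral>\<omega>. ?h (Suc N) \<omega> \<partial>M)"
        by (intro integral_mono integrable_positive_max g monoD[OF positive_max_mono]) simp
      ultimately show ?thesis by linarith
    qed
    ultimately have "0 \<le> (\<integral>\<omega>. g \<omega> \<partial>M)"
      by (intro LIMSEQ_le_const) auto
    then show False using neg by simp
  qed
  then have "prob B = 0" using ergodic_shift_one[OF B inv] by blast
  then have "AE \<omega> in M. \<omega> \<notin> B"
    using B by (simp add: prob_eq_0)
  then show ?thesis
    using AE_space
  proof eventually_elim
    case (elim \<omega>)
    then obtain k where "\<And>N. ?h N \<omega> \<le> real k" by (auto simp: B_def not_less)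
    then show ?case using sum_le_positive_max[of \<omega> g] elim by (meson order_trans)
  qed
qed

text \<open>For \<open>a\<close> strictly between the mean and \<open>m\<close>, the partial sums of
  \<open>f - a\<close> are bounded by some \<open>K\<close>, so the averages are at most
  \<open>a + K / N\<close>.\<close>

lemma ergodic_average_upper:
  fixes f :: "'a \<Rightarrow> real"
  assumes f: "integrable M f" and m: "(\<integral>\<omega>. f \<omega> \<partial>M) < m"
  shows "AE \<omega> in M. \<forall>\<^sub>F N in sequentially. (\<Sum>i<N. f (\<tau> (int i) \<omega>)) / real N < m"
proof -
  define a where "a = ((\<integral>\<omega>. f \<omega> \<partial>M) + m) / 2"
  have a: "(\<integral>\<omega>. f \<omega> \<partial>M) < a" "a < m" using m by (auto simp: a_def)
  have "AE \<omega> in M. \<exists>K. \<forall>N. (\<Sum>i<N. f (\<tau> (int i) \<omega>) - a) \<le> K"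
    using f a by (intro bounded_partial_sums_AE) (auto simp: prob_space)
  then show ?thesis
  proof eventually_elim
    case (elim \<omega>)
    then obtain K where K: "\<And>N. (\<Sum>i<N. f (\<tau> (int i) \<omega>)) \<le> K + real N * a"
      by (auto simp: sum_subtractf algebra_simps)
    obtain N0 :: nat where "K / (m - a) < real N0" using reals_Archimedean2 by blast
    then have N0: "K < real N0 * (m - a)" using a by (simp add: field_simps)
    show ?case
      using eventually_ge_at_top[of "Suc N0"]
    proof eventually_elim
      case (elim N)
      then have "real N0 * (m - a) \<le> real N * (m - a)" using a by (intro mult_right_mono) auto
      then have "(\<Sum>i<N. f (\<tau> (int i) \<omega>)) < m * real N"
        using K[of N] N0 by (simp add: algebra_simps)
      then show ?case using elim by (simp add: divide_less_eq)
    qed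
  qed
qed

text \<open>The lower estimate is the upper one for \<open>- f\<close>. Margins
  \<open>1 / Suc k\<close> keep the exceptional set a countable union of null sets.\<close>

lemma ergodic_average_tendsto:
  fixes f :: "'a \<Rightarrow> real"
  assumes f: "integrable M f"
  shows "AE \<omega> in M. (\<lambda>N. (\<Sum>i<N. f (\<tau> (int i) \<omega>)) / real N) \<longlonglongrightarrow> (\<integral>\<omega>. f \<omega> \<partial>M)"
proof -
  let ?m = "\<integral>\<omega>. f \<omega> \<partial>M"
  let ?e = "\<lambda>k. 1 / real (Suc k)"
  have "AE \<omega> in M. \<forall>k. \<forall>\<^sub>F N in sequentially. (\<Sum>i<N. f (\<tau> (int i) \<omega>)) / real N < ?m + ?e k"
    by (subst AE_all_countable, intro allI ergodic_average_upper f) simp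
  moreover have "AE \<omega> in M. \<forall>k. \<forall>\<^sub>F N in sequentially. (\<Sum>i<N. - f (\<tau> (int i) \<omega>)) / real N < - ?m + ?e k"
    by (subst AE_all_countable, intro allI ergodic_average_upper) (use f in simp_all)
  ultimately show ?thesis
  proof eventually_elim
    case (elim \<omega>)
    show ?case
    proof (rule tendstoI)
      fix e :: real assume "0 < e"
      then obtain k where k: "?e k < e" using nat_approx_posE by blast
      show "\<forall>\<^sub>F N in sequentially. dist ((\<Sum>i<N. f (\<tau> (int i) \<omega>)) / real N) ?m < e"
        using elim(1)[rule_format, of k] elim(2)[rule_format, of k]
        by eventually_elim (use k in \<open>auto simp: dist_real_def sum_negf\<close>)
    qed
  qed
qed

end

section \<open>A single potential\<close>

text \<open>Collects what the deterministic argument needs of one realisation. The constant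
  \<open>c\<close> is a parameter so that all bonds of a chain can share it;
  \<open>vanishing\<close> is obtained by squeezing with the bound \<open>\<psi>p\<close> of
  (A2).\<close>

locale single_well =
  fixes W :: "real \<Rightarrow> ereal" and c :: real
  assumes regular: "C3_pos W"
    and nonpos_infinite: "z \<le> 0 \<Longrightarrow> W z = \<infinity>"
    and unique_minimum: "\<exists>!z. is_arg_min W (\<lambda>_. True) z"
    and c_pos: "0 < c"
    and c_less_ground: "c < ground_state W"
    and curvature: "\<And>z. ground_state W - c < z \<Longrightarrow> z < ground_state W + c \<Longrightarrow> c \<le> pot_deriv 2 W z"
    and frac_pos: "0 < z_frac W"
    and mono_beyond_frac: "mono_on {z. z_frac W \<le> ereal z} W"
    and vanishing: "(W \<longlongrightarrow> 0) at_top"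
begin

abbreviation "\<delta> \<equiv> ground_state W"

abbreviation "w \<equiv> pot_deriv 0 W"

lemma ground_pos: "0 < \<delta>"
  using c_pos c_less_ground by linarith

lemma W_eq: "0 < z \<Longrightarrow> W z = ereal (w z)"
  using regular unfolding C3_pos_def pot_deriv_def by (simp add: ereal_real)

lemma deriv_pot_deriv:
  assumes "k < 3" "0 < z"
  shows "(pot_deriv k W has_real_derivative pot_deriv (Suc k) W z) (at z)"
proof -
  have "pot_deriv k W differentiable (at z)"
    using regular assms unfolding C3_pos_def by blast
  moreover have "pot_deriv (Suc k) W = deriv (pot_deriv k W)"
    by (simp add: pot_deriv_def)
  ultimately show ?thesis
    by (simp add: DERIV_deriv_iff_real_differentiable)
qed

lemma deriv_w: "0 < z \<Longrightarrow> (w has_real_derivative pot_deriv 1 W z) (at z)"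
  using deriv_pot_deriv[of 0 z] by simp

lemma deriv_w': "0 < z \<Longrightarrow> (pot_deriv 1 W has_real_derivative pot_deriv 2 W z) (at z)"
  using deriv_pot_deriv[of 1 z] by (simp add: numeral_2_eq_2)

lemma ground_arg_min: "is_arg_min W (\<lambda>_. True) \<delta>"
  unfolding ground_state_def using unique_minimum by (rule theI')

lemma ground_le: "W \<delta> \<le> W z"
  using ground_arg_min by (auto simp: is_arg_min_def not_less)

lemma ground_unique: "W z \<le> W \<delta> \<Longrightarrow> z = \<delta>"
proof -
  assume "W z \<le> W \<delta>"
  then have "is_arg_min W (\<lambda>_. True) z"
    using ground_le by (auto simp: is_arg_min_def not_less intro: order_trans)
  then show "z = \<delta>" using unique_minimum ground_arg_min by blast
qed

lemma w_ground_le: "0 < z \<Longrightarrow> w \<delta> \<le> w z"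
  using ground_le[of z] by (simp add: W_eq ground_pos)

lemma deriv_ground: "pot_deriv 1 W \<delta> = 0"
  using deriv_w[OF ground_pos] ground_pos
  by (rule DERIV_local_min) (auto intro!: w_ground_le)

section \<open>Shape of the potential: fracture point, monotonicity and the elastic bound\<close>

lemma convex_below_frac:
  assumes "0 < z" "ereal z < z_frac W"
  shows "0 < pot_deriv 2 W z"
  using assms unfolding z_frac_def less_SUP_iff by auto

text \<open>If the fracture point were at most \<open>\<delta>\<close>, growth beyond it and
  uniqueness of the minimizer would make the two equal; the curvature bound then pushes convexity
  past \<open>\<delta>\<close>, contradicting the supremum.\<close>

lemma ground_less_frac: "ereal \<delta> < z_frac W"
proof (rule ccontr)
  assume "\<not> ereal \<delta> < z_frac W"
  then have le: "z_frac W \<le> ereal \<delta>" by simp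
  then obtain zf where zf: "z_frac W = ereal zf"
    using frac_pos by (cases "z_frac W") auto
  have "zf = \<delta>"
  proof (rule ccontr)
    assume "zf \<noteq> \<delta>"
    then have "W zf \<le> W \<delta>"
      using le zf by (intro mono_onD[OF mono_beyond_frac]) auto
    then show False using ground_unique \<open>zf \<noteq> \<delta>\<close> by blast
  qed
  have "0 < pot_deriv 2 W s" if "0 < s" "s < \<delta> + c" for s
  proof (cases "s < \<delta>")
    case True
    then show ?thesis using that zf \<open>zf = \<delta>\<close> by (intro convex_below_frac) auto
  next
    case False
    then show ?thesis using that curvature[of s] c_pos by auto
  qed
  then have "ereal (\<delta> + c) \<le> z_frac W"
    unfolding z_frac_def using c_pos ground_pos by (intro SUP_upper) auto
  then show False using zf \<open>zf = \<delta>\<close> c_pos by simp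
qed

lemma w'_mono_below_frac:
  assumes "0 < x" "x < y" "ereal y < z_frac W"
  shows "pot_deriv 1 W x < pot_deriv 1 W y"
proof (rule DERIV_pos_imp_increasing[OF assms(2)])
  fix z assume "x \<le> z" "z \<le> y"
  then have "0 < z" "ereal z < z_frac W"
    using assms by (auto elim: le_less_trans[rotated])
  then show "\<exists>d. (pot_deriv 1 W has_real_derivative d) (at z) \<and> 0 < d"
    using deriv_w' convex_below_frac by blast
qed

lemma w_strict_decreasing:
  assumes "0 < x" "x < y" "y \<le> \<delta>"
  shows "w y < w x"
proof -
  obtain z where z: "x < z" "z < y" "w y - w x = (y - x) * pot_deriv 1 W z"
    using MVT2[OF \<open>x < y\<close>, of w "pot_deriv 1 W"] deriv_w assms by force
  have "pot_deriv 1 W z < 0"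
    using w'_mono_below_frac[of z \<delta>] z assms ground_less_frac deriv_ground by simp
  then have "(y - x) * pot_deriv 1 W z < 0"
    using assms by (intro mult_pos_neg) auto
  then show ?thesis using z by linarith
qed

lemma W_decreasing:
  assumes "x \<le> y" "y \<le> \<delta>"
  shows "W y \<le> W x"
proof (cases "0 < x \<and> x < y")
  case True
  then show ?thesis using w_strict_decreasing[of x y] assms by (simp add: W_eq)
next
  case False
  then show ?thesis using assms nonpos_infinite[of x] by (cases "0 < x") auto
qed

text \<open>The endpoint \<open>y\<close> may be the fracture point itself, because the mean value
  theorem evaluates the derivative only in the interior.\<close>

lemma w_strict_increasing:
  assumes "\<delta> \<le> x" "x < y" "ereal y \<le> z_frac W"
  shows "w x < w y"
proof -
  obtain z where z: "x < z" "z < y" "w y - w x = (y - x) * pot_deriv 1 W z"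
    using MVT2[OF \<open>x < y\<close>, of w "pot_deriv 1 W"] deriv_w assms ground_pos by force
  have "ereal z < z_frac W"
    using z assms by (metis less_ereal.simps(1) less_le_trans)
  then have "0 < pot_deriv 1 W z"
    using w'_mono_below_frac[of \<delta> z] z assms deriv_ground ground_pos by simp
  then have "(y - x) * pot_deriv 1 W z > 0"
    using assms by (intro mult_pos_pos) auto
  then show ?thesis using z by linarith
qed

lemma W_increasing:
  assumes "\<delta> \<le> x" "x \<le> y"
  shows "W x \<le> W y"
proof -
  have below: "W x \<le> W y" if "\<delta> \<le> x" "x \<le> y" "ereal y \<le> z_frac W" for x y
    using that w_strict_increasing[of x y] ground_pos
    by (cases "x = y") (auto simp: W_eq)
  \<comment> \<open>Convexity gives growth up to the fracture point and (A3) beyond it; an interval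
    containing that point is split there.\<close>
  consider "ereal y \<le> z_frac W" | "z_frac W \<le> ereal x"
    | zf where "z_frac W = ereal zf" "x \<le> zf" "zf \<le> y"
    by (cases "z_frac W") force+
  then show ?thesis
  proof cases
    case 1
    then show ?thesis using below assms by blast
  next
    case 2
    then have "z_frac W \<le> ereal y" using assms by (meson ereal_less_eq(3) order_trans)
    then show ?thesis using 2 assms by (intro mono_onD[OF mono_beyond_frac]) auto
  next
    case 3
    have "W x \<le> W zf" using 3 assms by (intro below) auto
    also have "W zf \<le> W y" using 3 by (intro mono_onD[OF mono_beyond_frac]) auto
    finally show ?thesis .
  qed
qed

text \<open>An increasing function with limit 0 at infinity is nonpositive. This caps the energy of
  a broken bond however far it is stretched.\<close>

lemma W_nonpos: "\<delta> \<le> z \<Longrightarrow> W z \<le> 0"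
  using vanishing
  by (rule tendsto_lowerbound)
    (auto intro!: W_increasing eventually_mono[OF eventually_ge_at_top[of z]])

text \<open>Curvature makes the slope at \<open>\<delta> + s\<close> at least \<open>c * s\<close>,
  and convexity preserves this up to the fracture point; below \<open>\<delta> + s\<close> the added
  term is nonpositive. The bound is affine in \<open>z\<close>, so its sum over a chain sees the
  stretches only through their total.\<close>

lemma elastic_lower_bound:
  assumes s: "0 < s" "s < c" and z: "0 < z" "ereal z \<le> z_frac W"
  shows "w \<delta> + c * s * (z - \<delta> - s) \<le> w z"
proof (cases "z \<le> \<delta> + s")
  case True
  then have "c * s * (z - \<delta> - s) \<le> 0"
    using s by (intro mult_nonneg_nonpos) auto
  then show ?thesis using w_ground_le[OF z(1)] by linarith
next
  case False
  let ?a = "\<delta> + s"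
  obtain x where x: "?a < x" "x < z" "w z - w ?a = (z - ?a) * pot_deriv 1 W x"
    using MVT2[of ?a z w "pot_deriv 1 W"] False deriv_w ground_pos s by force
  obtain y where y: "\<delta> < y" "y < ?a"
      "pot_deriv 1 W ?a - pot_deriv 1 W \<delta> = (?a - \<delta>) * pot_deriv 2 W y"
    using MVT2[of \<delta> ?a "pot_deriv 1 W" "pot_deriv 2 W"] deriv_w' ground_pos s by force
  have "c * s \<le> pot_deriv 1 W ?a"
    using y(3) mult_left_mono[OF curvature[of y], of s] y s unfolding deriv_ground
    by (simp add: mult.commute)
  moreover have "ereal x < z_frac W"
    using x z by (metis less_ereal.simps(1) less_le_trans)
  then have "pot_deriv 1 W ?a < pot_deriv 1 W x"
    using w'_mono_below_frac[of ?a x] x s ground_pos by simp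
  ultimately have "c * s * (z - ?a) \<le> pot_deriv 1 W x * (z - ?a)"
    using False by (intro mult_right_mono) auto
  moreover have "w \<delta> \<le> w ?a" using s ground_pos by (intro w_ground_le) simp
  ultimately show ?thesis using x(3) by (simp add: algebra_simps)
qed

text \<open>Gives the measurability of the ground state in \<open>\<omega>\<close>.\<close>

lemma ground_less_iff:
  "\<delta> < a \<longleftrightarrow> (\<exists>p q :: rat. 0 < p \<and> p < q \<and> of_rat q < a \<and> W (of_rat p) < W (of_rat q))"
proof
  assume "\<delta> < a"
  \<comment> \<open>Staying below both \<open>a\<close> and \<open>z_frac W\<close> leaves room for
    two rationals between which \<open>W\<close> strictly increases.\<close>
  then have "ereal \<delta> < min (ereal a) (z_frac W)" using ground_less_frac by simp
  then obtain b where b: "\<delta> < b" "b < a" "ereal b < z_frac W"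
    using ereal_dense2 by (metis less_ereal.simps(1) min_less_iff_conj)
  obtain q :: rat where q: "\<delta> < of_rat q" "of_rat q < b"
    using of_rat_dense[OF b(1)] by blast
  obtain p :: rat where p: "\<delta> < of_rat p" "(of_rat p :: real) < of_rat q"
    using of_rat_dense[OF q(1)] by blast
  have p0: "0 < (of_rat p :: real)" using p ground_pos by linarith
  have "ereal (of_rat q) \<le> z_frac W"
    using q b by (metis ereal_less_eq(3) less_imp_le order_trans)
  then have "w (of_rat p) < w (of_rat q)"
    using p by (intro w_strict_increasing) auto
  then have "W (of_rat p) < W (of_rat q)"
    using W_eq[OF p0] W_eq[OF less_trans[OF p0 p(2)]] by simp
  then show "\<exists>p q :: rat. 0 < p \<and> p < q \<and> of_rat q < a \<and> W (of_rat p) < W (of_rat q)"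
    using p p0 q b by (intro exI[of _ p] exI[of _ q]) (auto simp: of_rat_less)
next
  assume "\<exists>p q :: rat. 0 < p \<and> p < q \<and> of_rat q < a \<and> W (of_rat p) < W (of_rat q)"
  then obtain p q :: rat where pq: "0 < p" "p < q" "of_rat q < a" "W (of_rat p) < W (of_rat q)"
    by blast
  \<comment> \<open>\<open>W\<close> does not rise before \<open>\<delta>\<close>, so a rise from
    \<open>p\<close> to \<open>q\<close> puts \<open>q\<close> beyond it.\<close>
  have "\<not> (of_rat q \<le> \<delta>)"
    using pq W_decreasing[of "of_rat p" "of_rat q"] by (auto simp: of_rat_less_eq not_le[symmetric])
  then show "\<delta> < a" using pq by linarith
qed

lemma W_ground: "W \<delta> = ereal (w \<delta>)"
  using W_eq ground_pos by blast

text \<open>Bonds of an admissible chain may have stretch 0, where \<open>W\<close> is infinite and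
  the bound is trivial.\<close>

lemma elastic_lower_bound_ereal:
  assumes "0 < s" "s < c" "ereal z \<le> z_frac W"
  shows "ereal (w \<delta> + c * s * (z - \<delta> - s)) \<le> W z"
  using elastic_lower_bound[OF assms(1,2) _ assms(3)] W_eq[of z] nonpos_infinite[of z]
  by (cases "0 < z") auto

end

section \<open>Chains and their bond stretches\<close>

lemma bond_stretch_nonneg:
  assumes "u \<in> deformations n" "i < n"
  shows "0 \<le> bond_stretch n u i"
proof -
  have "u (real i / real n) \<le> u (real (i + 1) / real n)"
    using assms by (auto simp: deformations_def divide_simps intro!: mono_onD[of "{0..1}" u])
  then show ?thesis by (simp add: bond_stretch_def)
qed

lemma sum_bond_stretch:
  assumes "u \<in> clamped_deformations n l" "0 < n"
  shows "(\<Sum>i<n. bond_stretch n u i) = real n * l"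
proof -
  have "(\<Sum>i<n. u (real (Suc i) / real n) - u (real i / real n)) = u (real n / real n) - u (real 0 / real n)"
    by (rule sum_lessThan_telescope)
  then show ?thesis
    using assms by (simp add: bond_stretch_def clamped_deformations_def sum_distrib_left[symmetric])
qed

text \<open>The piecewise affine chain with prescribed stretches. Each clipped ramp rises from 0 to
  1 across its own cell, so continuity and monotonicity need no case split between cells.\<close>

definition chain_of_stretches :: "nat \<Rightarrow> (nat \<Rightarrow> real) \<Rightarrow> real \<Rightarrow> real" where
  "chain_of_stretches n z x = (\<Sum>j<n. z j * max 0 (min 1 (real n * x - real j))) / real n"

lemma bond_stretch_chain_of_stretches:
  assumes "i < n"
  shows "bond_stretch n (chain_of_stretches n z) i = z i"
proof -
  have "bond_stretch n (chain_of_stretches n z) i =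
      (\<Sum>j<n. z j * max 0 (min 1 (real (i + 1) - real j))) - (\<Sum>j<n. z j * max 0 (min 1 (real i - real j)))"
    using assms by (simp add: bond_stretch_def chain_of_stretches_def right_diff_distrib)
  also have "\<dots> = (\<Sum>j<n. if j = i then z j else 0)"
    unfolding sum_subtractf[symmetric] by (intro sum.cong) (auto simp: max_def min_def)
  finally show ?thesis using assms by simp
qed

lemma chain_of_stretches_clamped:
  assumes n: "0 < n" and z: "\<And>i. i < n \<Longrightarrow> 0 \<le> z i"
  shows "chain_of_stretches n z \<in> clamped_deformations n ((\<Sum>i<n. z i) / real n)"
proof -
  let ?u = "chain_of_stretches n z"
  have "?u 0 = 0" by (simp add: chain_of_stretches_def)
  moreover have "?u 1 = (\<Sum>i<n. z i) / real n"
    unfolding chain_of_stretches_def by (intro arg_cong2[of _ _ _ _ "(/)"] sum.cong) auto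
  moreover have "continuous_on {0..1} ?u"
    unfolding chain_of_stretches_def using n by (intro continuous_intros) auto
  moreover have "mono_on {0..1} ?u"
    unfolding chain_of_stretches_def
    by (intro mono_onI divide_right_mono sum_mono mult_left_mono max.mono min.mono diff_right_mono z) auto
  moreover have "\<exists>a b. \<forall>x\<in>{real i / real n <..< real (i + 1) / real n}. ?u x = a * x + b" if i: "i < n" for i
  proof (intro exI ballI)
    fix x assume "x \<in> {real i / real n <..< real (i + 1) / real n}"
    then have x: "real i < real n * x" "real n * x < real i + 1"
      using n by (auto simp: field_simps)
    \<comment> \<open>On cell \<open>i\<close> the earlier ramps are full and the later ones still
      zero; only ramp \<open>i\<close> varies.\<close>
    have "(\<Sum>j<n. z j * max 0 (min 1 (real n * x - real j)))
        = (\<Sum>j<n. (if j = i then z i * (real n * x - real i) else 0) + (if j < i then z j else 0))"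
    proof (intro sum.cong refl)
      fix j
      consider "j = i" | "real j + 1 \<le> real i" | "real i + 1 \<le> real j" by linarith
      then show "z j * max 0 (min 1 (real n * x - real j))
          = (if j = i then z i * (real n * x - real i) else 0) + (if j < i then z j else 0)"
        using x by cases (auto simp: max_def min_def)
    qed
    also have "\<dots> = z i * (real n * x - real i) + (\<Sum>j<n. if j < i then z j else 0)"
      using i by (simp add: sum.distrib)
    finally show "?u x = z i * x + ((\<Sum>j<n. if j < i then z j else 0) - z i * real i) / real n"
      using n by (simp add: chain_of_stretches_def field_simps)
  qed
  ultimately show ?thesis
    by (simp add: clamped_deformations_def deformations_def)
qed

section \<open>The critical stretch\<close>

lemma elastically_optimal_upto_mean_ground_state:
  assumes n: "0 < n"
    and well: "\<And>i. i < n \<Longrightarrow> single_well (J (\<tau> (int i) \<omega>)) c"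
  shows "elastically_optimal_below \<tau> J n \<omega>
    (ereal ((\<Sum>i<n. ground_state (J (\<tau> (int i) \<omega>))) / real n))"
  unfolding elastically_optimal_below_def
proof (intro allI impI antisym)
  let ?W = "\<lambda>i. J (\<tau> (int i) \<omega>)"
  let ?g = "\<lambda>i. ground_state (?W i)"
  fix l :: real
  assume l: "0 \<le> l \<and> ereal l < ereal ((\<Sum>i<n. ?g i) / real n)"
  show "(INF u\<in>clamped_deformations n l. energy \<tau> J n \<omega> u)
    \<le> (INF u\<in>elastic_deformations \<tau> J n \<omega> \<inter> clamped_deformations n l. energy \<tau> J n \<omega> u)"
    by (rule INF_superset_mono) auto
  show "(INF u\<in>elastic_deformations \<tau> J n \<omega> \<inter> clamped_deformations n l. energy \<tau> J n \<omega> u)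
    \<le> (INF u\<in>clamped_deformations n l. energy \<tau> J n \<omega> u)"
  proof (rule INF_greatest)
    fix u assume u: "u \<in> clamped_deformations n l"
    define z where "z = bond_stretch n u"
    \<comment> \<open>At \<open>t = 0\<close> this is the smaller of stretch and ground state, at
      \<open>t = 1\<close> the ground state, so the total crosses \<open>real n * l\<close> in
      between.\<close>
    define y where "y t i = (if ?g i < z i then ?g i else z i + t * (?g i - z i))" for t i
    have z_nonneg: "0 \<le> z i" if "i < n" for i
      using bond_stretch_nonneg[of u n i] u that by (simp add: z_def clamped_deformations_def)
    have sum_z: "(\<Sum>i<n. z i) = real n * l"
      using sum_bond_stretch[OF u n] by (simp add: z_def)
    have "\<exists>t\<ge>0. t \<le> 1 \<and> (\<Sum>i<n. y t i) = real n * l"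
    proof (rule IVT')
      show "(\<Sum>i<n. y 0 i) \<le> real n * l"
        unfolding sum_z[symmetric] by (intro sum_mono) (simp add: y_def)
      have "(\<Sum>i<n. y 1 i) = (\<Sum>i<n. ?g i)"
        by (intro sum.cong) (auto simp: y_def)
      then show "real n * l \<le> (\<Sum>i<n. y 1 i)"
        using l n by (simp add: field_simps)
      show "continuous_on {0..1} (\<lambda>t. \<Sum>i<n. y t i)"
      proof (intro continuous_on_sum)
        show "continuous_on {0..1} (\<lambda>t. y t i)" for i
          by (cases "?g i < z i") (auto simp: y_def intro!: continuous_intros)
      qed
    qed simp
    then obtain t where t: "0 \<le> t" "t \<le> 1" and sum_y: "(\<Sum>i<n. y t i) = real n * l"
      by blast
    have y: "0 \<le> y t i" "y t i \<le> ?g i" "?W i (y t i) \<le> ?W i (z i)" if i: "i < n" for i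
    proof -
      interpret single_well "?W i" c using well[OF i] .
      have "0 \<le> y t i \<and> y t i \<le> ?g i \<and> ?W i (y t i) \<le> ?W i (z i)"
      proof (cases "?g i < z i")
        case True
        then show ?thesis using ground_pos ground_le by (simp add: y_def)
      next
        case False
        then have "0 \<le> t * (?g i - z i)" "t * (?g i - z i) \<le> 1 * (?g i - z i)"
          using t mult_right_mono[of t 1 "?g i - z i"] by auto
        then have "z i \<le> y t i" "y t i \<le> ?g i"
          using False by (auto simp: y_def)
        then show ?thesis
          using z_nonneg[OF i] W_decreasing by auto
      qed
      then show "0 \<le> y t i" "y t i \<le> ?g i" "?W i (y t i) \<le> ?W i (z i)" by blast+
    qed
    let ?v = "chain_of_stretches n (y t)"
    have v: "?v \<in> clamped_deformations n l"
      using chain_of_stretches_clamped[of n "y t"] n y by (simp add: sum_y)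
    have "ereal (y t i) \<le> z_frac (?W i)" if "i < n" for i
      using y(2)[OF that] single_well.ground_less_frac[OF well[OF that]]
      by (meson ereal_less_eq(3) less_imp_le order_trans)
    then have "?v \<in> elastic_deformations \<tau> J n \<omega>"
      using v by (simp add: elastic_deformations_def clamped_deformations_def bond_stretch_chain_of_stretches)
    moreover have "energy \<tau> J n \<omega> ?v \<le> energy \<tau> J n \<omega> u"
      unfolding energy_def
      by (intro sum_mono ereal_mult_left_mono)
        (use y z_def in \<open>auto simp: bond_stretch_chain_of_stretches\<close>)
    ultimately show "(INF u\<in>elastic_deformations \<tau> J n \<omega> \<inter> clamped_deformations n l. energy \<tau> J n \<omega> u)
        \<le> energy \<tau> J n \<omega> u"
      using v by (intro INF_lower2) auto
  qed
qed

text \<open>The hypothesis \<open>large\<close> says that breaking bond \<open>0\<close>, which costs at most \<open>- J \<omega> (\<delta> \<omega>) / n\<close>, is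
  cheaper than the energy of an elastic chain stretched by \<open>2 * s\<close> beyond the mean ground state.\<close>

lemma critical_stretch_le_mean_ground_state:
  assumes n: "0 < n"
    and well: "\<And>i. i < n \<Longrightarrow> single_well (J (\<tau> (int i) \<omega>)) c"
    and s: "0 < s" "s < c"
    and large: "- pot_deriv 0 (J (\<tau> 0 \<omega>)) (ground_state (J (\<tau> 0 \<omega>))) < c * s * s * real n"
  shows "critical_stretch \<tau> J n \<omega>
    \<le> ereal ((\<Sum>i<n. ground_state (J (\<tau> (int i) \<omega>))) / real n + 2 * s)"
  unfolding critical_stretch_eq_Sup
proof (rule Sup_least, clarify, rule ccontr)
  let ?W = "\<lambda>i. J (\<tau> (int i) \<omega>)"
  let ?g = "\<lambda>i. ground_state (?W i)"
  let ?e = "\<lambda>i. pot_deriv 0 (?W i) (?g i)"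
  \<comment> \<open>One \<open>s\<close> of the excess offsets the shift by \<open>s\<close> in the
    elastic lower bound; the other yields the gain \<open>c * s * s\<close> per bond.\<close>
  define l where "l = (\<Sum>i<n. ?g i) / real n + 2 * s"
  fix L
  assume opt: "elastically_optimal_below \<tau> J n \<omega> L"
    and "\<not> L \<le> ereal ((\<Sum>i<n. ?g i) / real n + 2 * s)"
  then have "ereal l < L" by (simp add: l_def)
  have g: "0 < ?g i" if "i < n" for i
    using single_well.ground_pos[OF well[OF that]] .
  then have "0 \<le> (\<Sum>i<n. ?g i)" by (intro sum_nonneg) (auto intro: less_imp_le)
  then have "0 \<le> l" using s by (simp add: l_def)
  with opt \<open>ereal l < L\<close> have eq:
    "(INF u\<in>elastic_deformations \<tau> J n \<omega> \<inter> clamped_deformations n l. energy \<tau> J n \<omega> u) =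
     (INF u\<in>clamped_deformations n l. energy \<tau> J n \<omega> u)"
    by (simp add: elastically_optimal_below_def)
  \<comment> \<open>Bond 0 takes the whole excess length, and all other bonds sit at their ground
    states.\<close>
  define z where "z i = ?g i + (if i = 0 then 2 * s * real n else 0)" for i
  let ?v = "chain_of_stretches n z"
  have "(\<Sum>i<n. z i) / real n = l"
    using n by (simp add: z_def l_def sum.distrib add_divide_distrib)
  moreover have "0 \<le> z i" if "i < n" for i
    using g[OF that] s by (simp add: z_def)
  ultimately have v: "?v \<in> clamped_deformations n l"
    using chain_of_stretches_clamped[OF n, of z] by simp
  \<comment> \<open>The bound 0 for bond 0 is written as \<open>?e 0 - ?e 0\<close>, so that the
    full sum of ground energies splits off.\<close>
  have "energy \<tau> J n \<omega> ?v \<le> (\<Sum>i<n. ereal (1 / real n) * ereal (?e i + (if i = 0 then - ?e 0 else 0)))"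
    unfolding energy_def
  proof (intro sum_mono ereal_mult_left_mono)
    fix i assume "i \<in> {..<n}"
    then have i: "i < n" by simp
    interpret single_well "?W i" c using well[OF i] .
    show "?W i (bond_stretch n ?v i) \<le> ereal (?e i + (if i = 0 then - ?e 0 else 0))"
      using W_nonpos[of "z i"] W_ground s i
      by (auto simp: bond_stretch_chain_of_stretches z_def zero_ereal_def)
  qed simp
  also have "\<dots> = ereal (((\<Sum>i<n. ?e i) - ?e 0) / real n)"
    using n by (simp add: sum.distrib sum_divide_distrib[symmetric])
  finally have upper: "energy \<tau> J n \<omega> ?v \<le> ereal (((\<Sum>i<n. ?e i) - ?e 0) / real n)" .
  have lower: "ereal (((\<Sum>i<n. ?e i) + c * s * s * real n) / real n) \<le> energy \<tau> J n \<omega> u"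
    if u: "u \<in> elastic_deformations \<tau> J n \<omega> \<inter> clamped_deformations n l" for u
  proof -
    let ?z = "bond_stretch n u"
    have "(\<Sum>i<n. ?e i + c * s * (?z i - ?g i - s))
        = (\<Sum>i<n. ?e i) + c * s * ((\<Sum>i<n. ?z i) - (\<Sum>i<n. ?g i) - real n * s)"
      by (simp add: sum.distrib sum_subtractf sum_distrib_left[symmetric])
    also have "(\<Sum>i<n. ?z i) = (\<Sum>i<n. ?g i) + 2 * s * real n"
      using sum_bond_stretch[of u n l] u n by (simp add: l_def distrib_left)
    also have "(\<Sum>i<n. ?e i) + c * s * ((\<Sum>i<n. ?g i) + 2 * s * real n - (\<Sum>i<n. ?g i) - real n * s)
        = (\<Sum>i<n. ?e i) + c * s * s * real n"
      by (simp add: algebra_simps)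
    finally have "ereal (((\<Sum>i<n. ?e i) + c * s * s * real n) / real n)
        = ereal (\<Sum>i<n. (1 / real n) * (?e i + c * s * (?z i - ?g i - s)))"
      unfolding sum_distrib_left[symmetric] by simp
    also have "\<dots> = (\<Sum>i<n. ereal (1 / real n) * ereal (?e i + c * s * (?z i - ?g i - s)))"
      by simp
    also have "\<dots> \<le> energy \<tau> J n \<omega> u"
      unfolding energy_def
    proof (intro sum_mono ereal_mult_left_mono)
      fix i assume "i \<in> {..<n}"
      then show "ereal (?e i + c * s * (?z i - ?g i - s)) \<le> ?W i (?z i)"
        using u by (intro single_well.elastic_lower_bound_ereal well s)
          (auto simp: elastic_deformations_def)
    qed simp
    finally show ?thesis .
  qed
  \<comment> \<open>By \<open>eq\<close> the elastic bound holds for the unrestricted infimum and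
    hence for \<open>?v\<close>; with \<open>upper\<close> this gives
    \<open>c * s * s * real n \<le> - ?e 0\<close>, against \<open>large\<close>.\<close>
  have "ereal (((\<Sum>i<n. ?e i) + c * s * s * real n) / real n)
    \<le> (INF u\<in>clamped_deformations n l. energy \<tau> J n \<omega> u)"
    unfolding eq[symmetric] by (intro INF_greatest lower)
  also have "\<dots> \<le> energy \<tau> J n \<omega> ?v"
    using v by (rule INF_lower)
  finally show False
    using upper large n by (auto dest: order_trans simp: divide_le_cancel)
qed

section \<open>The limit for a fixed environment\<close>

lemma critical_stretch_tendsto:
  assumes well: "\<And>i. single_well (J (\<tau> (int i) \<omega>)) c"
    and mean: "(\<lambda>n. (\<Sum>i<n. ground_state (J (\<tau> (int i) \<omega>))) / real n) \<longlonglongrightarrow> m"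
  shows "(\<lambda>n. critical_stretch \<tau> J n \<omega>) \<longlonglongrightarrow> ereal m"
proof (rule order_tendstoI)
  let ?m = "\<lambda>n. (\<Sum>i<n. ground_state (J (\<tau> (int i) \<omega>))) / real n"
  fix a assume "a < ereal m"
  then have "\<forall>\<^sub>F n in sequentially. a < ereal (?m n)"
    using mean by (intro order_tendstoD(1)[of _ "ereal m"]) simp_all
  then show "\<forall>\<^sub>F n in sequentially. a < critical_stretch \<tau> J n \<omega>"
    using eventually_gt_at_top[of 0]
  proof eventually_elim
    case (elim n)
    have "ereal (?m n) \<le> critical_stretch \<tau> J n \<omega>"
      unfolding critical_stretch_eq_Sup
      using elastically_optimal_upto_mean_ground_state[of n J \<tau> \<omega> c] elim(2) well
      by (intro Sup_upper) simp
    then show ?case using elim by simp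
  qed
next
  let ?m = "\<lambda>n. (\<Sum>i<n. ground_state (J (\<tau> (int i) \<omega>))) / real n"
  fix a assume "ereal m < a"
  then obtain b where b: "m < b" "ereal b < a"
    using ereal_dense2 by (metis less_ereal.simps(1))
  have c: "0 < c" using single_well.c_pos[OF well] .
  \<comment> \<open>Half of the gap \<open>b - m\<close> is left for the fluctuation of the mean and
    half for \<open>2 * s\<close>; \<open>c / 2\<close> ensures \<open>s < c\<close>.\<close>
  define s where "s = min ((b - m) / 4) (c / 2)"
  have s: "0 < s" "s < c" "2 * s \<le> (b - m) / 2" using b c by (auto simp: s_def min_def)
  have "\<forall>\<^sub>F n in sequentially. ?m n < (b + m) / 2"
    using mean b by (intro order_tendstoD(2)[of _ m]) simp_all
  moreover
  let ?K = "- pot_deriv 0 (J (\<tau> 0 \<omega>)) (ground_state (J (\<tau> 0 \<omega>)))"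
  \<comment> \<open>\<open>?K\<close> concerns bond 0 alone and does not depend on \<open>n\<close>,
    so the energy of order \<open>n\<close> eventually exceeds it.\<close>
  have "\<forall>\<^sub>F n in sequentially. ?K / (c * s * s) < real n"
    using filterlim_real_sequentially by (rule filterlim_at_top_dense[THEN iffD1, rule_format])
  ultimately show "\<forall>\<^sub>F n in sequentially. critical_stretch \<tau> J n \<omega> < a"
    using eventually_gt_at_top[of 0]
  proof eventually_elim
    case (elim n)
    have "0 < c * s * s" using c s by simp
    then have "?K < c * s * s * real n"
      using elim(2) unfolding pos_divide_less_eq[OF \<open>0 < c * s * s\<close>] by (simp add: mult.commute)
    then have "critical_stretch \<tau> J n \<omega> \<le> ereal (?m n + 2 * s)"
      using critical_stretch_le_mean_ground_state[of n J \<tau> \<omega> c s] elim(3) well s(1,2) by blast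
    also have "\<dots> \<le> ereal b" using elim(1) s(3) by (simp add: field_simps)
    finally show ?case using b by simp
  qed
qed

section \<open>Almost sure properties of the random potential and its mean ground state\<close>

context random_potential
begin

text \<open>The bound \<open>1 / c\<close> is kept because it makes the ground state
  integrable.\<close>

lemma single_well_AE: "\<exists>c>0. AE \<omega> in M. single_well (J \<omega>) c \<and> ground_state (J \<omega>) < 1 / c"
proof -
  obtain c where c: "0 < c" and A4': "AE \<omega> in M.
      c < ground_state (J \<omega>) \<and> ground_state (J \<omega>) < 1 / c \<and>
      (\<forall>z\<in>{ground_state (J \<omega>) - c <..< ground_state (J \<omega>) + c}.
         c \<le> pot_deriv 2 (J \<omega>) z \<and> pot_deriv 2 (J \<omega>) z \<le> 1 / c \<and>
         \<bar>pot_deriv 3 (J \<omega>) z\<bar> \<le> 1 / c)"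
    using A4 by blast
  obtain \<psi>p :: "real \<Rightarrow> real" where \<psi>p: "(\<psi>p \<longlongrightarrow> 0) at_top"
    and bound: "AE \<omega> in M. \<forall>z\<ge>1. \<bar>J \<omega> z\<bar> \<le> ereal (\<psi>p z)"
    using A2 by (auto simp: eventually_conj_iff)
  have "AE \<omega> in M. single_well (J \<omega>) c \<and> ground_state (J \<omega>) < 1 / c"
    using A1 A3 unique_minimizer A4' bound AE_space
  proof eventually_elim
    case (elim \<omega>)
    have "(J \<omega> \<longlongrightarrow> 0) at_top"
    proof (rule tendsto_sandwich)
      have "\<forall>\<^sub>F z in at_top. ereal (- \<psi>p z) \<le> J \<omega> z \<and> J \<omega> z \<le> ereal (\<psi>p z)"
        using eventually_ge_at_top[of 1]
      proof eventually_elim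
        case (elim z)
        then have "\<bar>J \<omega> z\<bar> \<le> ereal (\<psi>p z)" using \<open>\<forall>z\<ge>1. \<bar>J \<omega> z\<bar> \<le> ereal (\<psi>p z)\<close> by blast
        then show ?case by (cases "J \<omega> z") auto
      qed
      then show "\<forall>\<^sub>F z in at_top. ereal (- \<psi>p z) \<le> J \<omega> z" "\<forall>\<^sub>F z in at_top. J \<omega> z \<le> ereal (\<psi>p z)"
        by (auto elim: eventually_mono)
      show "((\<lambda>z. ereal (- \<psi>p z)) \<longlongrightarrow> 0) at_top" "((\<lambda>z. ereal (\<psi>p z)) \<longlongrightarrow> 0) at_top"
        using \<psi>p tendsto_minus[OF \<psi>p] by (auto simp: zero_ereal_def)
    qed
    then have "single_well (J \<omega>) c"
      using elim c potential_nonpos[of \<omega>] by unfold_locales auto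
    then show ?case using elim by blast
  qed
  then show ?thesis using c by blast
qed

lemma potential_section_measurable: "(\<lambda>\<omega>. J \<omega> z) \<in> borel_measurable M"
proof -
  have "(\<lambda>\<omega>. (\<omega>, z)) \<in> measurable M (M \<Otimes>\<^sub>M borel)" by simp
  from measurable_compose[OF this potential_measurable] show ?thesis by simp
qed

text \<open>The ergodic theorem needs an integrand measurable for \<open>M\<close> itself, so the
  ground state is set to 0 on a measurable null set containing all bad realisations.\<close>

lemma ground_state_AE_eq:
  obtains d where "integrable M d" "AE \<omega> in M. d \<omega> = ground_state (J \<omega>)"
    "integral\<^sup>L M d = mean_ground_state M J"
proof -
  obtain c where c: "0 < c"
    and well: "AE \<omega> in M. single_well (J \<omega>) c \<and> ground_state (J \<omega>) < 1 / c"
    using single_well_AE by blast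
  from AE_E[OF well] obtain N where
    N: "{\<omega> \<in> space M. \<not> (single_well (J \<omega>) c \<and> ground_state (J \<omega>) < 1 / c)} \<subseteq> N"
      "emeasure M N = 0" "N \<in> sets M"
    by blast
  have wellN: "single_well (J \<omega>) c" "ground_state (J \<omega>) < 1 / c"
    if "\<omega> \<in> space M" "\<omega> \<notin> N" for \<omega>
    using N(1) that by auto
  define d where "d \<omega> = (if \<omega> \<in> N then 0 else ground_state (J \<omega>))" for \<omega>
  note [measurable] = potential_section_measurable N(3)
  have d_measurable: "d \<in> borel_measurable M"
  proof (rule borel_measurableI_less)
    fix a
    \<comment> \<open>Off \<open>N\<close>, lying in a sublevel set amounts to countably many
      comparisons of \<open>J\<close> at rational points.\<close>
    have "{\<omega> \<in> space M. d \<omega> < a} = {\<omega> \<in> space M. if \<omega> \<in> N then 0 < a else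
        (\<exists>p q :: rat. 0 < p \<and> p < q \<and> of_rat q < a \<and> J \<omega> (of_rat p) < J \<omega> (of_rat q))}"
      using single_well.ground_less_iff[OF wellN(1)] by (auto simp: d_def)
    also have "\<dots> \<in> sets M" by measurable
    finally show "{\<omega> \<in> space M. d \<omega> < a} \<in> sets M" .
  qed
  have "norm (d \<omega>) \<le> 1 / c" if "\<omega> \<in> space M" for \<omega>
    using wellN[OF that] single_well.ground_pos[of "J \<omega>" c] c
    by (cases "\<omega> \<in> N") (auto simp: d_def)
  then have "integrable M d"
    using d_measurable by (intro integrable_const_bound[of _ "1 / c"]) auto
  moreover have d_eq: "AE \<omega> in M. d \<omega> = ground_state (J \<omega>)"
    using AE_not_in[of N M] N by (auto simp: d_def null_sets_def elim: eventually_mono)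
  moreover have "integral\<^sup>L M d = mean_ground_state M J"
  proof -
    \<comment> \<open>Its sublevel sets agree with those of \<open>d\<close> up to null sets, hence
      belong to the completion.\<close>
    have "(\<lambda>\<omega>. ground_state (J \<omega>)) \<in> borel_measurable (completion M)"
    proof (rule borel_measurableI_less)
      fix a
      show "{\<omega> \<in> space (completion M). ground_state (J \<omega>) < a} \<in> sets (completion M)"
      proof (rule completion.in_sets_AE)
        show "{\<omega> \<in> space M. d \<omega> < a} \<in> sets (completion M)"
          using d_measurable by (intro sets_completionI_sets) measurable
        show "AE \<omega> in completion M. \<omega> \<in> {\<omega> \<in> space M. d \<omega> < a} \<longleftrightarrow>
            \<omega> \<in> {\<omega> \<in> space (completion M). ground_state (J \<omega>) < a}"
          using AE_completion[OF d_eq] by eventually_elim simp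
      qed auto
    qed
    from integral_cong_AE[OF measurable_completion[OF d_measurable] this AE_completion[OF d_eq]]
    have "mean_ground_state M J = integral\<^sup>L (completion M) d"
      by (simp add: mean_ground_state_def)
    then show ?thesis by (simp add: integral_completion d_measurable)
  qed
  ultimately show ?thesis by (rule that)
qed

end

theorem theorem2p1:
  fixes M :: "'a measure"
    and \<tau> :: "int \<Rightarrow> 'a \<Rightarrow> 'a"
    and J :: "'a \<Rightarrow> real \<Rightarrow> ereal"
  assumes "ergodic_int_action M \<tau>"
    and "random_potential M J"
  shows "AE \<omega> in M. (\<lambda>n. critical_stretch \<tau> J n \<omega>) \<longlonglongrightarrow> ereal (mean_ground_state M J)"
proof -
  interpret ergodic_int_action M \<tau> by fact
  interpret random_potential M J by fact
  obtain c where "AE \<omega> in M. single_well (J \<omega>) c \<and> ground_state (J \<omega>) < 1 / c"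
    using single_well_AE by blast
  then have "AE \<omega> in M. \<forall>i. single_well (J (\<tau> i \<omega>)) c"
    by (intro AE_shift) auto
  moreover obtain d where d: "integrable M d" "AE \<omega> in M. d \<omega> = ground_state (J \<omega>)"
      "integral\<^sup>L M d = mean_ground_state M J"
    by (rule ground_state_AE_eq)
  \<comment> \<open>The ergodic theorem averages \<open>d\<close>, the chain averages
    \<open>ground_state\<close>; off one null set they agree along the whole orbit.\<close>
  note AE_shift[OF d(2)]
  moreover note ergodic_average_tendsto[OF d(1)]
  ultimately show ?thesis
  proof eventually_elim
    case (elim \<omega>)
    then show ?case using d(3) by (intro critical_stretch_tendsto[of J \<tau> \<omega> c]) simp_all
  qed
qed

end
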